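(* Let $P_{8a} = \mathrm{conv}\{(-1,-1),(-1,1),(1,-1),(1,1)\} \subset \mathbb{R}^2$ be the reflexive polygon with $9$ lattice points ($8$ of them on the boundary), and let $V$ be the toric variety (with standard scaling) associated to it. Then the log-linear model defined by $P_{8a}$ exhibits an ML degree drop. Concretely, $\deg(V) = 8$ and $\mathrm{mldeg}(V) = 4$.
   Context: For a lattice polytope $P \subset \mathbb{R}^d$ with lattice points $P\cap\mathbb{Z}^d = \{a_1,\dots,a_n\}$, the design matrix is $A = [a_1\ \cdots\ a_n] \in \mathbb{Z}^{d\times n}$, and $A'$ is $A$ with an additional first row of ones. The toric variety $V = V_A\subseteq \mathbb{C}^n$ (standard scaling) is the Zariski closure of the image of $\psi:(\mathbb{C}^* )^{d+1}\to(\mathbb{C}^* )^n$, $(s,\theta)\mapsto (s\theta^{a_1},\dots,s\theta^{a_n})$. It is the affine cone over a projective toric variety, and $\deg(V)$ is its degree. For data $u\in\mathbb{N}^n$ with $u_+ = \sum_i u_i$, the score equations are $A'p = \frac{1}{u_+}A'u$ with $p\in V\cap(\mathbb{C}^* )^n$, and $\mathrm{mldeg}(V)$ is the number of complex solutions $p$ for generic $u$. One always has $\mathrm{mldeg}(V)\le\deg(V)$; $P$ (or its model) exhibits an ML degree drop if $\mathrm{mldeg}(V)<\deg(V)$. *)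

theory Defs
  imports
    "HOL-Analysis.Analysis"
    "HOL-Computational_Algebra.Polynomial"
    "HOL-Library.Poly_Mapping"
begin

subsection \<open>Polynomials and the Zariski topology on affine space\<close>

text \<open>Coordinates of affine \<open>n\<close>-space are indexed by a finite type \<open>'n\<close>; a polynomial in these
  variables maps exponent vectors to coefficients.\<close>

type_synonym 'n cpoly = "('n \<Rightarrow>\<^sub>0 nat) \<Rightarrow>\<^sub>0 complex"

definition cpoly_eval :: "'n::finite cpoly \<Rightarrow> complex ^ 'n \<Rightarrow> complex" where
  "cpoly_eval f x =
     (\<Sum>m\<in>Poly_Mapping.keys f. Poly_Mapping.lookup f m * (\<Prod>i\<in>UNIV. (x $ i) ^ Poly_Mapping.lookup m i))"

definition zero_locus :: "'n::finite cpoly set \<Rightarrow> (complex ^ 'n) set" where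
  "zero_locus F = {x. \<forall>f\<in>F. cpoly_eval f x = 0}"

definition vanishing_ideal :: "(complex ^ 'n::finite) set \<Rightarrow> 'n cpoly set" where
  "vanishing_ideal V = {f. \<forall>x\<in>V. cpoly_eval f x = 0}"

definition zariski_closed :: "(complex ^ 'n::finite) set \<Rightarrow> bool" where
  "zariski_closed Z \<longleftrightarrow> (\<exists>F. Z = zero_locus F)"

definition zariski_closure :: "(complex ^ 'n::finite) set \<Rightarrow> (complex ^ 'n) set" where
  "zariski_closure S = zariski_closed hull S"


subsection \<open>Degree of an affine cone\<close>

definition cpoly_scale :: "complex \<Rightarrow> 'n cpoly \<Rightarrow> 'n cpoly" where
  "cpoly_scale c f = Poly_Mapping.map ((*) c) f"

lemma lookup_cpoly_scale [simp]:
  "Poly_Mapping.lookup (cpoly_scale c f) m = c * Poly_Mapping.lookup f m"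
  by (simp add: cpoly_scale_def Poly_Mapping.map.rep_eq when_def)

global_interpretation cpoly: vector_space cpoly_scale
  by unfold_locales
    (auto intro!: poly_mapping_eqI simp: Poly_Mapping.lookup_add algebra_simps)

definition homogeneous_part :: "nat \<Rightarrow> 'n::finite cpoly set" where
  "homogeneous_part k =
     {f. \<forall>m\<in>Poly_Mapping.keys f. (\<Sum>i\<in>UNIV. Poly_Mapping.lookup m i) = k}"

text \<open>The dimension of the degree \<open>k\<close> part of \<open>\<complex>[x] / I(V)\<close>, for \<open>V\<close> an affine cone, so that
  \<open>I(V)\<close> is homogeneous. The subtraction does not truncate: the second space is a subspace of
  the first, which is finite-dimensional.\<close>

definition hilbert_function :: "(complex ^ 'n::finite) set \<Rightarrow> nat \<Rightarrow> nat" where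
  "hilbert_function V k =
     cpoly.dim (homogeneous_part k :: 'n cpoly set)
       - cpoly.dim (homogeneous_part k \<inter> vanishing_ideal V)"

definition hilbert_polynomial :: "(complex ^ 'n::finite) set \<Rightarrow> rat poly" where
  "hilbert_polynomial V =
     (THE h. \<forall>\<^sub>F k in sequentially. poly h (of_nat k) = of_nat (hilbert_function V k))"

text \<open>The degree of the projective variety underlying the cone \<open>V\<close>: the leading coefficient
  of the Hilbert polynomial times \<open>r!\<close>, where \<open>r\<close>, the degree of the Hilbert polynomial, is the
  dimension of the projective variety.\<close>

definition cone_degree :: "(complex ^ 'n::finite) set \<Rightarrow> rat" where
  "cone_degree V =
     fact (degree (hilbert_polynomial V)) * lead_coeff (hilbert_polynomial V)"


subsection \<open>Lattice polytopes\<close>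

definition lattice_points :: "(real ^ 'd) set \<Rightarrow> (int ^ 'd) set" where
  "lattice_points P = {a. (\<chi> i. of_int (a $ i)) \<in> P}"

definition lattice_polytope :: "(real ^ 'd::finite) set \<Rightarrow> bool" where
  "lattice_polytope P \<longleftrightarrow>
     (\<exists>S :: (int ^ 'd) set. finite S \<and> P = convex hull ((\<lambda>a. \<chi> i. of_int (a $ i)) ` S))"

definition polar_dual :: "(real ^ 'd::finite) set \<Rightarrow> (real ^ 'd) set" where
  "polar_dual P = {y. \<forall>x\<in>P. x \<bullet> y \<ge> -1}"

definition reflexive :: "(real ^ 'd::finite) set \<Rightarrow> bool" where
  "reflexive P \<longleftrightarrow> lattice_polytope P \<and> 0 \<in> interior P \<and> lattice_polytope (polar_dual P)"


subsection \<open>Log-linear models and the maximum likelihood degree\<close>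

text \<open>The columns of \<open>A\<close> list the lattice points of \<open>P\<close>, each exactly once, in any order; in
  particular \<open>CARD('n)\<close> is the number of lattice points.\<close>

definition design_matrix :: "int ^ 'n ^ 'd \<Rightarrow> (real ^ 'd) set \<Rightarrow> bool" where
  "design_matrix A P \<longleftrightarrow> bij_betw (\<lambda>j. column j A) UNIV (lattice_points P)"

text \<open>The matrix \<open>A'\<close>: the row with index \<open>None\<close> is the additional row of ones.\<close>

definition extended_matrix :: "int ^ 'n ^ 'd \<Rightarrow> complex ^ 'n ^ ('d option)" where
  "extended_matrix A =
     (\<chi> r j. case r of None \<Rightarrow> 1 | Some i \<Rightarrow> of_int (A $ i $ j))"

definition toric_map :: "int ^ 'n ^ 'd::finite \<Rightarrow> complex \<Rightarrow> complex ^ 'd \<Rightarrow> complex ^ 'n" where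
  "toric_map A s \<theta> = (\<chi> j. s * (\<Prod>i\<in>UNIV. (\<theta> $ i) powi (column j A $ i)))"

definition toric_variety :: "int ^ 'n::finite ^ 'd::finite \<Rightarrow> (complex ^ 'n) set" where
  "toric_variety A = zariski_closure {toric_map A s \<theta> | s \<theta>. s \<noteq> 0 \<and> (\<forall>i. \<theta> $ i \<noteq> 0)}"

definition score_solutions :: "int ^ 'n::finite ^ 'd::finite \<Rightarrow> nat ^ 'n \<Rightarrow> (complex ^ 'n) set" where
  "score_solutions A u =
     {p \<in> toric_variety A. (\<forall>j. p $ j \<noteq> 0) \<and>
        extended_matrix A *v p =
          (1 / of_nat (\<Sum>j\<in>UNIV. u $ j)) *s (extended_matrix A *v (\<chi> j. of_nat (u $ j)))}"

text \<open>A property of data vectors holds generically if it holds for all data outside a proper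
  Zariski closed subset of affine space. Since \<open>\<nat>\<^sup>n\<close> is Zariski dense, two such properties always
  have a common instance; the exceptional set may contain \<open>u = 0\<close>, where the score equations are
  not defined.\<close>

definition generic_data :: "(nat ^ 'n::finite \<Rightarrow> bool) \<Rightarrow> bool" where
  "generic_data Q \<longleftrightarrow>
     (\<exists>f :: 'n cpoly. f \<noteq> 0 \<and> (\<forall>u. cpoly_eval f (\<chi> j. of_nat (u $ j)) \<noteq> 0 \<longrightarrow> Q u))"

definition mldeg :: "int ^ 'n::finite ^ 'd::finite \<Rightarrow> nat" where
  "mldeg A =
     (THE m. generic_data (\<lambda>u. finite (score_solutions A u) \<and> card (score_solutions A u) = m))"

definition ml_degree_drop :: "int ^ 'n::finite ^ 'd::finite \<Rightarrow> bool" where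
  "ml_degree_drop A \<longleftrightarrow> of_nat (mldeg A) < cone_degree (toric_variety A)"


definition P8a :: "(real ^ 2) set" where
  "P8a = convex hull {vector [-1, -1], vector [-1, 1], vector [1, -1], vector [1, 1]}"

end

theory Submission
  imports Defs
begin

text \<open>The polygon is the square \<open>[-1, 1]\<^sup>2\<close>, and both numbers come from its product structure.

  Degree. A form of degree \<open>k\<close> vanishes on the toric variety exactly when, for each lattice point
  \<open>b\<close>, the coefficients of its monomials of multidegree \<open>b\<close> sum to zero, because Laurent
  monomials with distinct exponents are linearly independent on the torus. Hence the Hilbert
  function at \<open>k\<close> counts the sums of \<open>k\<close> columns of \<open>A\<close>
  (\<open>hilbert_function_toric_variety\<close>). For the square these are all lattice points of
  \<open>[-k, k]\<^sup>2\<close>, and there are \<open>(2 k + 1)\<^sup>2 = 4 k\<^sup>2 + 4 k + 1\<close> of them, which gives degree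
  \<open>2! \<cdot> 4 = 8\<close>.

  Maximum likelihood degree. A point of the variety without zero coordinates is the image of a
  torus point \<open>(s, x, y)\<close>, which it determines, because the columns of \<open>A\<close> include \<open>0\<close> and the unit vectors
  (\<open>toric_variety_torus_point\<close>). With \<open>g(x) = 1/x + 1 + x\<close> and \<open>d(x) = x - 1/x\<close> the score
  equations read \<open>s g(x) g(y) = 1\<close>, \<open>s d(x) g(y) = \<beta>\<^sub>1\<close> and \<open>s g(x) d(y) = \<beta>\<^sub>2\<close>, where
  \<open>\<beta>\<close> is the mean of the lattice points weighted by the data. They decouple into
  \<open>d(x) = \<beta>\<^sub>1 g(x)\<close> and \<open>d(y) = \<beta>\<^sub>2 g(y)\<close>, two quadratic equations, each with two
  admissible roots as soon as all counts are positive. So there are \<open>2 \<cdot> 2 = 4\<close> solutions. This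
  is the generic number and the only one, because the points with natural coordinates are Zariski
  dense (\<open>generic_data_common_instance\<close>).

  The independence of Laurent monomials and this density both rest on restricting to a curve
  \<open>t \<mapsto> (t ^ w i)\<^sub>i\<close> along which finitely many given exponents stay distinct
  (\<open>separating_weights\<close>).\<close>

section \<open>Evaluation of monomials and polynomials\<close>

abbreviation (input) lookup where "lookup \<equiv> Poly_Mapping.lookup"
abbreviation (input) keys where "keys \<equiv> Poly_Mapping.keys"
abbreviation (input) mon :: "('n \<Rightarrow>\<^sub>0 nat) \<Rightarrow> 'n cpoly" where "mon m \<equiv> Poly_Mapping.single m 1"

definition mon_value :: "('n::finite \<Rightarrow>\<^sub>0 nat) \<Rightarrow> complex ^ 'n \<Rightarrow> complex" where
  "mon_value m x = (\<Prod>i\<in>UNIV. (x $ i) ^ lookup m i)"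

lemma mon_value_add: "mon_value (m + m') x = mon_value m x * mon_value m' x"
  by (simp add: mon_value_def lookup_add power_add prod.distrib)

lemma mon_value_single: "mon_value (Poly_Mapping.single j k) x = (x $ j) ^ k"
proof -
  have "mon_value (Poly_Mapping.single j k) x = (\<Prod>i\<in>UNIV. if i = j then (x $ j) ^ k else 1)"
    unfolding mon_value_def by (rule prod.cong) (auto simp: lookup_single when_def)
  then show ?thesis by simp
qed

lemma mon_value_sum: "mon_value (\<Sum>i\<in>I. m i) x = (\<Prod>i\<in>I. mon_value (m i) x)"
proof (induction I rule: infinite_finite_induct)
  case empty
  then show ?case by (simp add: mon_value_def)
qed (auto simp: mon_value_add, simp add: mon_value_def)

lemma cpoly_eval_superset:
  assumes "finite K" "keys f \<subseteq> K"
  shows "cpoly_eval f x = (\<Sum>m\<in>K. lookup f m * mon_value m x)"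
  unfolding cpoly_eval_def mon_value_def
  by (rule sum.mono_neutral_left) (use assms in \<open>auto simp: in_keys_iff\<close>)

lemma cpoly_eval_diff: "cpoly_eval (f - g) x = cpoly_eval f x - cpoly_eval g x"
proof -
  define K where "K = keys f \<union> keys g"
  have "keys (f - g) \<subseteq> K" by (auto simp: K_def in_keys_iff lookup_minus)
  then show ?thesis
    by (simp add: cpoly_eval_superset[where K = K] K_def lookup_minus algebra_simps
        sum_subtractf)
qed

lemma cpoly_eval_mon [simp]: "cpoly_eval (mon m) x = mon_value m x"
  by (simp add: cpoly_eval_superset[where K = "{m}"])

lemma vanishing_ideal_zariski_closure:
  "vanishing_ideal (zariski_closure S) = vanishing_ideal S"
proof
  have "S \<subseteq> zariski_closure S" unfolding zariski_closure_def by (rule hull_subset)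
  then show "vanishing_ideal (zariski_closure S) \<subseteq> vanishing_ideal S"
    by (auto simp: vanishing_ideal_def)
  show "vanishing_ideal S \<subseteq> vanishing_ideal (zariski_closure S)"
  proof
    fix f assume "f \<in> vanishing_ideal S"
    then have "S \<subseteq> zero_locus {f}" by (auto simp: vanishing_ideal_def zero_locus_def)
    moreover have "zariski_closed (zero_locus {f})" by (auto simp: zariski_closed_def)
    ultimately have "zariski_closure S \<subseteq> zero_locus {f}"
      unfolding zariski_closure_def by (rule hull_minimal)
    then show "f \<in> vanishing_ideal (zariski_closure S)"
      by (auto simp: vanishing_ideal_def zero_locus_def)
  qed
qed


section \<open>Laurent polynomials along monomial curves\<close>

text \<open>The weights are powers \<open>t ^ \<kappa> i\<close> of one integer \<open>t\<close>, with distinct exponents: the weights of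
  two vectors agree only if \<open>t\<close> is a root of a nonzero polynomial, whose coefficients are the
  entries of the difference of the vectors, so all but finitely many \<open>t\<close> separate \<open>B\<close>.\<close>

lemma separating_weights:
  fixes B :: "(int ^ 'd::finite) set"
  assumes "finite B"
  obtains w :: "'d \<Rightarrow> nat" where "inj_on (\<lambda>b. \<Sum>i\<in>UNIV. int (w i) * b $ i) B"
proof -
  obtain \<kappa> :: "'d \<Rightarrow> nat" where \<kappa>: "inj \<kappa>"
    using finite_imp_inj_to_nat_seg[of "UNIV :: 'd set"] by auto
  define P :: "int ^ 'd \<Rightarrow> int ^ 'd \<Rightarrow> int poly"
    where "P b b' = (\<Sum>i\<in>UNIV. monom (b $ i - b' $ i) (\<kappa> i))" for b b'
  have "coeff (P b b') (\<kappa> i) = b $ i - b' $ i" for b b' i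
    using \<kappa> by (simp add: P_def coeff_sum inj_eq)
  then have P: "P b b' \<noteq> 0" if "b \<noteq> b'" for b b'
    using that by (metis coeff_0 eq_iff_diff_eq_0 vec_eq_iff)
  define R where "R = (\<Union>b\<in>B. \<Union>b'\<in>B - {b}. {t. poly (P b b') t = 0})"
  have "finite R"
    unfolding R_def using assms P by (intro finite_UN_I) (auto intro!: poly_roots_finite)
  moreover have "infinite (range int)"
    by (simp add: finite_image_iff)
  ultimately obtain t where t: "int t \<notin> R"
    by (metis finite_subset image_subsetI)
  have "inj_on (\<lambda>b. \<Sum>i\<in>UNIV. int (t ^ \<kappa> i) * b $ i) B"
  proof (rule inj_onI, rule ccontr)
    fix b b'
    assume *: "b \<in> B" "b' \<in> B" "b \<noteq> b'"
      "(\<Sum>i\<in>UNIV. int (t ^ \<kappa> i) * b $ i) = (\<Sum>i\<in>UNIV. int (t ^ \<kappa> i) * b' $ i)"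
    then have "poly (P b b') (int t) = 0"
      by (simp add: P_def poly_sum poly_monom algebra_simps sum_subtractf)
    then show False using t * by (auto simp: R_def)
  qed
  then show thesis by (rule that)
qed

text \<open>Along the curve \<open>t \<mapsto> (t ^ w i)\<^sub>i\<close> the Laurent polynomial becomes one in the single
  variable \<open>t\<close>, in which no two terms collide. This one fact gives both that a Laurent polynomial
  vanishing on the torus is zero and that points with natural coordinates are Zariski dense.\<close>

lemma finite_laurent_zeros_on_curve:
  fixes B :: "(int ^ 'd::finite) set" and w :: "'d \<Rightarrow> nat" and c :: "int ^ 'd \<Rightarrow> complex"
  assumes "finite B" and inj: "inj_on (\<lambda>b. \<Sum>i\<in>UNIV. int (w i) * b $ i) B"
    and "b\<^sub>0 \<in> B" "c b\<^sub>0 \<noteq> 0"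
  shows "finite {t::nat. t > 0 \<and>
    (\<Sum>b\<in>B. c b * (\<Prod>i\<in>UNIV. (of_nat t ^ w i) powi (b $ i))) = 0}"
proof -
  define e where "e b = (\<Sum>i\<in>UNIV. int (w i) * b $ i)" for b :: "int ^ 'd"
  define M where "M = (\<Sum>b\<in>B. \<bar>e b\<bar>)"
  have M: "e b + M \<ge> 0" if "b \<in> B" for b
    using member_le_sum[of b B "\<lambda>b. \<bar>e b\<bar>"] that \<open>finite B\<close> by (auto simp: M_def)
  have "M \<ge> 0" by (simp add: M_def sum_nonneg)
  define P where "P = (\<Sum>b\<in>B. monom (c b) (nat (e b + M)))"
  have "nat (e b + M) = nat (e b\<^sub>0 + M) \<longleftrightarrow> b = b\<^sub>0" if "b \<in> B" for b
    using inj_onD[OF inj, of b b\<^sub>0] M[of b] M[of b\<^sub>0] that assms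
    by (auto simp: e_def)
  then have "coeff P (nat (e b\<^sub>0 + M)) = (\<Sum>b\<in>B. if b = b\<^sub>0 then c b else 0)"
    unfolding P_def coeff_sum by (intro sum.cong) auto
  then have "P \<noteq> 0" using assms by auto
  have "poly P (of_nat t) = of_nat t ^ nat M *
      (\<Sum>b\<in>B. c b * (\<Prod>i\<in>UNIV. (of_nat t ^ w i) powi (b $ i)))" if "t > 0" for t :: nat
  proof -
    have pw: "(of_nat t :: complex) powi (\<Sum>i\<in>I. g i) = (\<Prod>i\<in>I. of_nat t powi g i)"
      for I :: "'d set" and g
      using that by (induction I rule: infinite_finite_induct) (auto simp: power_int_add)
    have "(of_nat t :: complex) ^ nat (e b + M) = of_nat t ^ nat M *
        (\<Prod>i\<in>UNIV. (of_nat t ^ w i) powi (b $ i))" if "b \<in> B" for b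
    proof -
      have "(of_nat t :: complex) ^ nat (e b + M) = of_nat t powi (e b + M)"
        using M[OF that] by (simp add: power_int_def)
      also have "\<dots> = of_nat t powi e b * of_nat t powi M"
        using \<open>t > 0\<close> by (simp add: power_int_add)
      also have "\<dots> = of_nat t powi e b * of_nat t ^ nat M"
        using \<open>M \<ge> 0\<close> by (simp add: power_int_def)
      finally show ?thesis
        by (simp add: e_def pw power_int_power)
    qed
    then show ?thesis
      by (simp add: P_def poly_sum poly_monom sum_distrib_left mult.left_commute)
  qed
  then have "{t::nat. t > 0 \<and>
      (\<Sum>b\<in>B. c b * (\<Prod>i\<in>UNIV. (of_nat t ^ w i) powi (b $ i))) = 0}
    \<subseteq> of_nat -` {z. poly P z = 0}"
    by auto
  moreover have "finite (of_nat -` {z. poly P z = 0} :: nat set)"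
    using poly_roots_finite[OF \<open>P \<noteq> 0\<close>] by (intro finite_vimageI) (auto simp: inj_def)
  ultimately show ?thesis by (rule finite_subset)
qed

lemma laurent_coeffs_eq_0:
  fixes B :: "(int ^ 'd::finite) set" and c :: "int ^ 'd \<Rightarrow> complex"
  assumes "finite B"
    and zero: "\<And>\<theta> :: complex ^ 'd. \<forall>i. \<theta> $ i \<noteq> 0 \<Longrightarrow>
      (\<Sum>b\<in>B. c b * (\<Prod>i\<in>UNIV. (\<theta> $ i) powi (b $ i))) = 0"
    and "b \<in> B"
  shows "c b = 0"
proof (rule ccontr)
  assume "c b \<noteq> 0"
  obtain w :: "'d \<Rightarrow> nat" where w: "inj_on (\<lambda>b. \<Sum>i\<in>UNIV. int (w i) * b $ i) B"
    using separating_weights[OF \<open>finite B\<close>] .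
  have "(\<Sum>b\<in>B. c b * (\<Prod>i\<in>UNIV. (of_nat t ^ w i) powi (b $ i))) = 0" if "t > 0" for t :: nat
    using zero[of "\<chi> i. of_nat t ^ w i"] that by simp
  then have "{0<..} = {t::nat. t > 0 \<and>
      (\<Sum>b\<in>B. c b * (\<Prod>i\<in>UNIV. (of_nat t ^ w i) powi (b $ i))) = 0}"
    by auto
  also have "finite \<dots>"
    using \<open>c b \<noteq> 0\<close> by (intro finite_laurent_zeros_on_curve[OF \<open>finite B\<close> w \<open>b \<in> B\<close>])
  finally show False using infinite_Ioi by blast
qed

text \<open>Two nonzero polynomials restrict to nonzero polynomials on one and the same curve, so some
  natural parameter avoids the zeros of both.\<close>

lemma generic_data_common_instance:
  fixes Q R :: "nat ^ 'n::finite \<Rightarrow> bool"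
  assumes "generic_data Q" "generic_data R"
  shows "\<exists>u. Q u \<and> R u"
proof -
  obtain f g :: "'n cpoly" where f: "f \<noteq> 0" "\<And>u. cpoly_eval f (\<chi> j. of_nat (u $ j)) \<noteq> 0 \<Longrightarrow> Q u"
    and g: "g \<noteq> 0" "\<And>u. cpoly_eval g (\<chi> j. of_nat (u $ j)) \<noteq> 0 \<Longrightarrow> R u"
    using assms unfolding generic_data_def by auto
  define expo :: "('n \<Rightarrow>\<^sub>0 nat) \<Rightarrow> int ^ 'n" where "expo m = (\<chi> i. int (lookup m i))" for m
  have "inj expo"
    by (auto simp: inj_def expo_def vec_eq_iff intro: poly_mapping_eqI)
  define K where "K = keys f \<union> keys g"
  have "finite K" by (simp add: K_def)
  obtain w :: "'n \<Rightarrow> nat" where w: "inj_on (\<lambda>b. \<Sum>i\<in>UNIV. int (w i) * b $ i) (expo ` K)"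
    using separating_weights[of "expo ` K"] \<open>finite K\<close> by auto
  have fin: "finite {t::nat. t > 0 \<and> cpoly_eval h (\<chi> j. of_nat (t ^ w j)) = 0}"
    if "keys h \<subseteq> K" "h \<noteq> 0" for h
  proof -
    obtain m where m: "m \<in> keys h" using \<open>h \<noteq> 0\<close> by (metis keys_eq_empty ex_in_conv)
    define c where "c b = lookup h (inv expo b)" for b
    have "cpoly_eval h (\<chi> j. of_nat (t ^ w j)) =
        (\<Sum>b\<in>expo ` K. c b * (\<Prod>i\<in>UNIV. (of_nat t ^ w i) powi (b $ i)))" for t :: nat
      using \<open>inj expo\<close> \<open>finite K\<close> that
      by (simp add: cpoly_eval_superset[of K] sum.reindex[OF inj_on_subset[of expo UNIV]]
          c_def mon_value_def) (simp add: expo_def)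
    moreover have "expo m \<in> expo ` K" "c (expo m) \<noteq> 0"
      using m that \<open>inj expo\<close> by (auto simp: c_def in_keys_iff)
    ultimately show ?thesis
      using finite_laurent_zeros_on_curve[OF _ w] \<open>finite K\<close> by simp
  qed
  have "finite ({t::nat. t > 0 \<and> cpoly_eval f (\<chi> j. of_nat (t ^ w j)) = 0} \<union>
      {t::nat. t > 0 \<and> cpoly_eval g (\<chi> j. of_nat (t ^ w j)) = 0})"
    using fin[of f] fin[of g] f g by (auto simp: K_def)
  then obtain t :: nat where "t > 0" "cpoly_eval f (\<chi> j. of_nat (t ^ w j)) \<noteq> 0"
      "cpoly_eval g (\<chi> j. of_nat (t ^ w j)) \<noteq> 0"
    using infinite_Ioi[of "0::nat"]
    by (smt (verit) UnCI finite_subset greaterThan_iff mem_Collect_eq subsetI)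
  then have "Q (\<chi> j. t ^ w j)" "R (\<chi> j. t ^ w j)"
    using f(2)[of "\<chi> j. t ^ w j"] g(2)[of "\<chi> j. t ^ w j"] by simp_all
  then show ?thesis by blast
qed


section \<open>The Hilbert function of a toric variety\<close>

definition monomials :: "nat \<Rightarrow> ('n::finite \<Rightarrow>\<^sub>0 nat) set" where
  "monomials k = {m. (\<Sum>j\<in>UNIV. lookup m j) = k}"

definition multidegree :: "int ^ 'n::finite ^ 'd \<Rightarrow> ('n \<Rightarrow>\<^sub>0 nat) \<Rightarrow> int ^ 'd" where
  "multidegree A m = (\<chi> i. \<Sum>j\<in>UNIV. int (lookup m j) * A $ i $ j)"

lemma homogeneous_part_iff: "f \<in> homogeneous_part k \<longleftrightarrow> keys f \<subseteq> monomials k"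
  by (auto simp: homogeneous_part_def monomials_def)

lemma finite_monomials: "finite (monomials k :: ('n::finite \<Rightarrow>\<^sub>0 nat) set)"
proof -
  have "lookup m j \<le> k" if "m \<in> monomials k" for m :: "'n \<Rightarrow>\<^sub>0 nat" and j
    using member_le_sum[of j UNIV "lookup m"] that by (simp add: monomials_def)
  then have "lookup ` (monomials k :: ('n \<Rightarrow>\<^sub>0 nat) set) \<subseteq> PiE UNIV (\<lambda>_. {..k})"
    by auto
  then have "finite (lookup ` (monomials k :: ('n \<Rightarrow>\<^sub>0 nat) set))"
    by (rule finite_subset) (simp add: finite_PiE)
  then show ?thesis
    by (rule finite_imageD) (auto simp: inj_on_def intro: poly_mapping_eqI)
qed

text \<open>The coefficient functionals at the exponents in \<open>N\<close> are dual to the family \<open>v\<close>, so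
  \<open>v\<close> is independent; the last hypothesis says that it spans \<open>W\<close>.\<close>

lemma dim_eq_card_if_dual_family:
  fixes W :: "'n cpoly set"
  assumes "finite N" and "v ` N \<subseteq> W"
    and dual: "\<And>m m'. m \<in> N \<Longrightarrow> m' \<in> N \<Longrightarrow> lookup (v m) m' = (if m = m' then 1 else 0)"
    and expand: "\<And>f. f \<in> W \<Longrightarrow> f = (\<Sum>m\<in>N. cpoly_scale (lookup f m) (v m))"
  shows "cpoly.dim W = card N"
proof -
  have inj: "inj_on v N"
  proof (rule inj_onI)
    fix m m' assume "m \<in> N" "m' \<in> N" "v m = v m'"
    then show "m = m'" using dual[of m m'] dual[of m' m'] by (auto split: if_splits)
  qed
  have "cpoly.independent (v ` N)"
  proof (rule cpoly.independent_if_scalars_zero)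
    show "finite (v ` N)" using \<open>finite N\<close> by simp
    fix g x assume sum0: "(\<Sum>x\<in>v ` N. cpoly_scale (g x) x) = 0" and "x \<in> v ` N"
    then obtain m' where m': "m' \<in> N" "x = v m'" by auto
    have "0 = lookup (\<Sum>m\<in>N. cpoly_scale (g (v m)) (v m)) m'"
      using sum0 inj by (simp add: sum.reindex)
    also have "\<dots> = (\<Sum>m\<in>N. if m = m' then g (v m) else 0)"
      unfolding lookup_sum by (rule sum.cong) (auto simp: dual m')
    finally show "g x = 0" using m' \<open>finite N\<close> by simp
  qed
  moreover have "W \<subseteq> cpoly.span (v ` N)"
  proof
    fix f assume "f \<in> W"
    have "(\<Sum>m\<in>N. cpoly_scale (lookup f m) (v m)) \<in> cpoly.span (v ` N)"
      by (intro cpoly.span_sum cpoly.span_scale cpoly.span_base) auto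
    then show "f \<in> cpoly.span (v ` N)" using expand[OF \<open>f \<in> W\<close>] by simp
  qed
  moreover have "card (v ` N) = card N" using inj by (rule card_image)
  ultimately show ?thesis using cpoly.dim_unique[OF \<open>v ` N \<subseteq> W\<close>] by blast
qed

lemma dim_homogeneous_part:
  "cpoly.dim (homogeneous_part k :: 'n::finite cpoly set) = card (monomials k :: ('n \<Rightarrow>\<^sub>0 nat) set)"
proof (rule dim_eq_card_if_dual_family[where v = mon])
  fix f :: "'n cpoly" assume "f \<in> homogeneous_part k"
  then have f: "lookup f m = 0" if "m \<notin> monomials k" for m
    using that by (auto simp: homogeneous_part_iff in_keys_iff)
  have "lookup (\<Sum>m\<in>monomials k. cpoly_scale (lookup f m) (mon m)) m' =
      (\<Sum>m\<in>monomials k. if m = m' then lookup f m else 0)" for m'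
    unfolding lookup_sum by (rule sum.cong) (auto simp: lookup_single when_def)
  also have "\<dots> m' = lookup f m'" for m'
    using f by (simp add: finite_monomials)
  finally show "f = (\<Sum>m\<in>monomials k. cpoly_scale (lookup f m) (mon m))"
    by (intro poly_mapping_eqI) simp
qed (auto simp: finite_monomials homogeneous_part_iff lookup_single when_def)

lemma mon_value_toric_map:
  assumes "m \<in> monomials k" and "\<forall>i. \<theta> $ i \<noteq> 0"
  shows "mon_value m (toric_map A s \<theta>) =
    s ^ k * (\<Prod>i\<in>UNIV. (\<theta> $ i) powi (multidegree A m $ i))"
proof -
  have pw: "(\<theta> $ i) powi (\<Sum>j\<in>J. g j) = (\<Prod>j\<in>J. (\<theta> $ i) powi g j)"
    for J :: "'a set" and g i
    using assms(2) by (induction J rule: infinite_finite_induct) (auto simp: power_int_add)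
  have "mon_value m (toric_map A s \<theta>) =
      (\<Prod>j\<in>UNIV. s ^ lookup m j) * (\<Prod>j\<in>UNIV. \<Prod>i\<in>UNIV. ((\<theta> $ i) powi (A $ i $ j)) ^ lookup m j)"
    by (simp add: mon_value_def toric_map_def column_def power_mult_distrib prod.distrib
        prod_power_distrib)
  also have "(\<Prod>j\<in>UNIV. s ^ lookup m j) = s ^ k"
    using assms(1) by (simp add: monomials_def flip: power_sum)
  also have "(\<Prod>j\<in>UNIV. \<Prod>i\<in>UNIV. ((\<theta> $ i) powi (A $ i $ j)) ^ lookup m j) =
      (\<Prod>i\<in>UNIV. \<Prod>j\<in>UNIV. (\<theta> $ i) powi (int (lookup m j) * A $ i $ j))"
    by (subst prod.swap) (simp add: power_int_power' mult.commute)
  also have "\<dots> = (\<Prod>i\<in>UNIV. (\<theta> $ i) powi (multidegree A m $ i))"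
    by (simp add: multidegree_def pw)
  finally show ?thesis .
qed

text \<open>A form of degree \<open>k\<close> pulls back to \<open>s ^ k\<close> times a Laurent polynomial in \<open>\<theta>\<close>, whose
  coefficient at \<open>b\<close> collects the coefficients of the monomials of multidegree \<open>b\<close>.\<close>

lemma vanishing_ideal_toric_variety_iff:
  assumes "f \<in> homogeneous_part k"
  shows "f \<in> vanishing_ideal (toric_variety A) \<longleftrightarrow>
    (\<forall>b\<in>multidegree A ` monomials k. (\<Sum>m | m \<in> monomials k \<and> multidegree A m = b. lookup f m) = 0)"
proof -
  define c where "c b = (\<Sum>m | m \<in> monomials k \<and> multidegree A m = b. lookup f m)" for b
  have eval: "cpoly_eval f (toric_map A s \<theta>) = s ^ k *
      (\<Sum>b\<in>multidegree A ` monomials k. c b * (\<Prod>i\<in>UNIV. (\<theta> $ i) powi (b $ i)))"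
    if \<theta>: "\<forall>i. \<theta> $ i \<noteq> 0" for s \<theta>
  proof -
    have "cpoly_eval f (toric_map A s \<theta>) =
        (\<Sum>m\<in>monomials k. lookup f m * mon_value m (toric_map A s \<theta>))"
      using assms by (simp add: cpoly_eval_superset[OF finite_monomials] homogeneous_part_iff)
    also have "\<dots> = (\<Sum>m\<in>monomials k.
        lookup f m * (s ^ k * (\<Prod>i\<in>UNIV. (\<theta> $ i) powi (multidegree A m $ i))))"
      by (simp add: mon_value_toric_map[OF _ \<theta>])
    also have "\<dots> = (\<Sum>b\<in>multidegree A ` monomials k.
        \<Sum>m | m \<in> monomials k \<and> multidegree A m = b.
          lookup f m * (s ^ k * (\<Prod>i\<in>UNIV. (\<theta> $ i) powi (multidegree A m $ i))))"
      by (rule sum.image_gen) (rule finite_monomials)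
    also have "\<dots> = (\<Sum>b\<in>multidegree A ` monomials k.
        c b * (s ^ k * (\<Prod>i\<in>UNIV. (\<theta> $ i) powi (b $ i))))"
      unfolding c_def sum_distrib_right by (intro sum.cong refl) auto
    finally show ?thesis by (simp add: sum_distrib_left mult.left_commute)
  qed
  have "f \<in> vanishing_ideal (toric_variety A) \<longleftrightarrow>
      (\<forall>s \<theta>. s \<noteq> 0 \<and> (\<forall>i. \<theta> $ i \<noteq> 0) \<longrightarrow> cpoly_eval f (toric_map A s \<theta>) = 0)"
    unfolding toric_variety_def vanishing_ideal_zariski_closure
    by (auto simp: vanishing_ideal_def)
  also have "\<dots> \<longleftrightarrow> (\<forall>\<theta> :: complex ^ 'b. (\<forall>i. \<theta> $ i \<noteq> 0) \<longrightarrow>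
      (\<Sum>b\<in>multidegree A ` monomials k. c b * (\<Prod>i\<in>UNIV. (\<theta> $ i) powi (b $ i))) = 0)"
    (is "?L \<longleftrightarrow> ?R")
  proof
    assume ?L
    then have "cpoly_eval f (toric_map A 1 \<theta>) = 0" if "\<forall>i. \<theta> $ i \<noteq> 0" for \<theta>
      using that by simp
    then show ?R by (simp add: eval)
  qed (simp add: eval)
  also have "\<dots> \<longleftrightarrow> (\<forall>b\<in>multidegree A ` monomials k. c b = 0)" (is "?L \<longleftrightarrow> ?R")
  proof
    assume ?L
    then show ?R
      by (intro ballI, intro laurent_coeffs_eq_0[of "multidegree A ` monomials k" c])
        (simp_all add: finite_monomials)
  next
    assume ?R
    then show ?L by (intro allI impI sum.neutral) simp
  qed
  finally show ?thesis by (simp add: c_def)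
qed

text \<open>Choose one monomial of degree \<open>k\<close> in each multidegree. Every other monomial minus the
  chosen one of the same multidegree is a binomial in the ideal, and these binomials form a basis
  of the degree \<open>k\<close> part of the ideal. What remains in the quotient is one monomial for
  each multidegree.\<close>

theorem hilbert_function_toric_variety:
  fixes A :: "int ^ 'n::finite ^ 'd::finite"
  shows "hilbert_function (toric_variety A) k = card (multidegree A ` monomials k)"
proof -
  define M where "M = (monomials k :: ('n \<Rightarrow>\<^sub>0 nat) set)"
  define W where "W = homogeneous_part k \<inter> vanishing_ideal (toric_variety A)"
  define r where "r m = inv_into M (multidegree A) (multidegree A m)" for m
  have [simp]: "finite M" by (simp add: M_def finite_monomials)
  have r_in: "r m \<in> M" and deg_r: "multidegree A (r m) = multidegree A m" if "m \<in> M" for m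
    using that by (auto simp: r_def inv_into_into f_inv_into_f)
  have r_eq_iff: "r m = r m' \<longleftrightarrow> multidegree A m = multidegree A m'" if "m \<in> M" "m' \<in> M" for m m'
    using deg_r that by (metis r_def)
  have rr: "r (r m) = r m" if "m \<in> M" for m
    using that by (simp add: r_eq_iff r_in deg_r)
  define N where "N = {m \<in> M. r m \<noteq> m}"
  have "N \<subseteq> M" "finite N" by (auto simp: N_def)
  have W_iff: "f \<in> W \<longleftrightarrow> keys f \<subseteq> M \<and>
      (\<forall>b\<in>multidegree A ` M. (\<Sum>m | m \<in> M \<and> multidegree A m = b. lookup f m) = 0)" for f
    using vanishing_ideal_toric_variety_iff[of f k A]
    by (auto simp: W_def homogeneous_part_iff M_def)
  define v :: "('n \<Rightarrow>\<^sub>0 nat) \<Rightarrow> 'n cpoly" where "v m = mon m - mon (r m)" for m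
  have lookup_v: "lookup (v m) m' = (if m = m' then 1 else 0) - (if r m = m' then 1 else 0)"
    for m m'
    by (simp add: v_def lookup_minus lookup_single when_def)
  have "cpoly.dim W = card N"
  proof (rule dim_eq_card_if_dual_family[where v = v])
    show "finite N" by fact
    show "v ` N \<subseteq> W"
    proof (rule image_subsetI)
      fix m assume "m \<in> N"
      then have m: "m \<in> M" "r m \<in> M" using r_in by (auto simp: N_def)
      then have "keys (v m) \<subseteq> M" by (auto simp: in_keys_iff lookup_v split: if_splits)
      moreover have "(\<Sum>m' | m' \<in> M \<and> multidegree A m' = b. lookup (v m) m') = 0" for b
        using m deg_r by (simp add: lookup_v sum_subtractf)
      ultimately show "v m \<in> W" by (simp add: W_iff)
    qed
    show "lookup (v m) m' = (if m = m' then 1 else 0)" if "m \<in> N" "m' \<in> N" for m m'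
      using that rr by (auto simp: lookup_v N_def)
    fix f assume "f \<in> W"
    have coeffs: "lookup f m' = (\<Sum>m\<in>N. lookup f m * lookup (v m) m')" for m'
    proof -
      have expand: "(\<Sum>m\<in>N. lookup f m * lookup (v m) m') =
          (if m' \<in> N then lookup f m' else 0) - (\<Sum>m | m \<in> N \<and> r m = m'. lookup f m)"
      proof -
        have "(\<Sum>m\<in>N. lookup f m * lookup (v m) m') =
            (\<Sum>m\<in>N. (if m = m' then lookup f m else 0) - (if r m = m' then lookup f m else 0))"
          by (rule sum.cong) (auto simp: lookup_v)
        then show ?thesis
          using \<open>finite N\<close> by (simp add: sum_subtractf sum.If_cases Int_def)
      qed
      consider "m' \<notin> M" | "m' \<in> N" | "m' \<in> M" "r m' = m'" by (auto simp: N_def)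
      then show ?thesis
      proof cases
        case 1
        then have none: "{m. m \<in> N \<and> r m = m'} = {}" using r_in \<open>N \<subseteq> M\<close> by auto
        show ?thesis using 1 \<open>f \<in> W\<close> \<open>N \<subseteq> M\<close>
          unfolding expand none by (auto simp: W_iff in_keys_iff)
      next
        case 2
        then have none: "{m. m \<in> N \<and> r m = m'} = {}" using rr by (auto simp: N_def)
        show ?thesis using 2 unfolding expand none by simp
      next
        case 3
        \<comment> \<open>The fibre of a chosen monomial is the monomial itself together with its part in \<open>N\<close>.\<close>
        have "{m. m \<in> M \<and> multidegree A m = multidegree A m'} =
            insert m' {m. m \<in> N \<and> r m = m'}"
        proof -
          have "multidegree A m = multidegree A m' \<longleftrightarrow> r m = m'" if "m \<in> M" for m
            using r_eq_iff[OF that 3(1)] unfolding 3(2) by blast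
          then show ?thesis using 3 by (auto simp: N_def)
        qed
        moreover have "(\<Sum>m | m \<in> M \<and> multidegree A m = multidegree A m'. lookup f m) = 0"
          using \<open>f \<in> W\<close> 3 by (auto simp: W_iff)
        moreover have "m' \<notin> N" using 3 by (simp add: N_def)
        ultimately show ?thesis
          using \<open>finite N\<close> unfolding expand by (simp add: eq_neg_iff_add_eq_0)
      qed
    qed
    show "f = (\<Sum>m\<in>N. cpoly_scale (lookup f m) (v m))"
      by (rule poly_mapping_eqI, subst coeffs) (simp add: lookup_sum)
  qed
  moreover have "card M = card N + card (r ` M)"
  proof -
    have "M = N \<union> r ` M"
      using r_in image_iff[of _ r M] by (fastforce simp: N_def)
    moreover have "N \<inter> r ` M = {}" using rr by (auto simp: N_def)
    ultimately have "card M = card (N \<union> r ` M)" "N \<inter> r ` M = {}" by simp_all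
    then show ?thesis using card_Un_disjoint[of N "r ` M"] \<open>finite N\<close> by simp
  qed
  moreover have "card (r ` M) = card (multidegree A ` M)"
  proof -
    have "r ` M = inv_into M (multidegree A) ` multidegree A ` M"
      by (simp add: r_def image_image)
    then show ?thesis by (simp add: card_image inj_on_inv_into)
  qed
  ultimately show ?thesis
    by (simp add: hilbert_function_def dim_homogeneous_part W_def M_def)
qed

text \<open>Multiplying a monomial by a variable adds a column of \<open>A\<close> to its multidegree, so the
  multidegrees of the monomials of degree \<open>k\<close> are the sums of \<open>k\<close> columns.\<close>

lemma multidegree_monomials_0:
  fixes A :: "int ^ 'n::finite ^ 'd"
  shows "multidegree A ` monomials 0 = {0}"
proof -
  have "m \<in> monomials 0 \<longleftrightarrow> m = 0" for m :: "'n \<Rightarrow>\<^sub>0 nat"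
    by (simp add: monomials_def poly_mapping_eq_iff fun_eq_iff)
  then have "monomials 0 = {0 :: 'n \<Rightarrow>\<^sub>0 nat}" by blast
  moreover have "multidegree A 0 = 0" by (simp add: multidegree_def vec_eq_iff)
  ultimately show ?thesis by simp
qed

lemma multidegree_monomials_Suc:
  fixes A :: "int ^ 'n::finite ^ 'd"
  shows "multidegree A ` monomials (Suc k) =
    {b + column j A | b j. b \<in> multidegree A ` monomials k}"
proof -
  have single_sum: "(\<Sum>i\<in>UNIV. lookup (Poly_Mapping.single j (1::nat)) i) = 1" for j :: 'n
  proof -
    have "(\<Sum>i\<in>UNIV. lookup (Poly_Mapping.single j (1::nat)) i) = (\<Sum>i\<in>UNIV. if i = j then 1 else 0)"
      by (rule sum.cong) (auto simp: lookup_single when_def)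
    then show ?thesis by simp
  qed
  have deg: "multidegree A (m + Poly_Mapping.single j 1) = multidegree A m + column j A" for m j
  proof -
    have "(\<Sum>j'\<in>UNIV. int (lookup (Poly_Mapping.single j (1::nat)) j') * A $ i $ j') = A $ i $ j" for i
    proof -
      have "(\<Sum>j'\<in>UNIV. int (lookup (Poly_Mapping.single j (1::nat)) j') * A $ i $ j') =
          (\<Sum>j'\<in>UNIV. if j' = j then A $ i $ j' else 0)"
        by (rule sum.cong) (auto simp: lookup_single when_def)
      then show ?thesis by simp
    qed
    then show ?thesis
      by (simp add: multidegree_def column_def vec_eq_iff lookup_add distrib_right sum.distrib)
  qed
  have "\<exists>m' j. m' \<in> monomials k \<and> m = m' + Poly_Mapping.single j 1"
    if "m \<in> monomials (Suc k)" for m :: "'n \<Rightarrow>\<^sub>0 nat"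
  proof -
    have "(\<Sum>j\<in>UNIV. lookup m j) \<noteq> 0" using that by (simp add: monomials_def)
    then obtain j where j: "lookup m j > 0" by auto
    define m' where "m' = m - Poly_Mapping.single j 1"
    have m: "m = m' + Poly_Mapping.single j 1"
      using j by (intro poly_mapping_eqI)
        (auto simp: m'_def lookup_add lookup_minus lookup_single when_def)
    have "m' \<in> monomials k"
      using that[unfolded m] single_sum[of j] by (simp add: monomials_def lookup_add sum.distrib)
    then show ?thesis using m by blast
  qed
  moreover have "m + Poly_Mapping.single j 1 \<in> monomials (Suc k)" if "m \<in> monomials k"
    for m and j :: 'n
    using that single_sum[of j] by (simp add: monomials_def lookup_add sum.distrib)
  ultimately have "monomials (Suc k) = (\<Union>j :: 'n. (\<lambda>m. m + Poly_Mapping.single j 1) ` monomials k)"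
    by (intro set_eqI iffI; blast)
  then have "multidegree A ` monomials (Suc k) =
      (\<Union>j. (\<lambda>m. multidegree A m + column j A) ` monomials k)"
    by (simp only: image_UN image_image deg)
  then show ?thesis by auto
qed

text \<open>Two polynomials that agree at all large integers are equal.\<close>

lemma hilbert_polynomial_eqI:
  assumes "\<forall>\<^sub>F k in sequentially. poly h (of_nat k) = of_nat (hilbert_function V k)"
  shows "hilbert_polynomial V = h"
  unfolding hilbert_polynomial_def
proof (rule the_equality)
  fix h' :: "rat poly"
  assume "\<forall>\<^sub>F k in sequentially. poly h' (of_nat k) = of_nat (hilbert_function V k)"
  with assms have "\<forall>\<^sub>F k in sequentially. poly (h' - h) (of_nat k) = 0"
    by eventually_elim simp
  then obtain k\<^sub>0 where "\<And>k. k \<ge> k\<^sub>0 \<Longrightarrow> poly (h' - h) (of_nat k) = 0"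
    by (auto simp: eventually_sequentially)
  then have "of_nat ` {k\<^sub>0..} \<subseteq> {x. poly (h' - h) x = 0}" by auto
  moreover have "infinite (of_nat ` {k\<^sub>0..} :: rat set)"
    using infinite_Ici[of k\<^sub>0] finite_imageD[of "of_nat :: nat \<Rightarrow> rat" "{k\<^sub>0..}"] by (auto simp: inj_on_def)
  ultimately show "h' = h"
    using poly_roots_finite[of "h' - h"] by (metis eq_iff_diff_eq_0 finite_subset)
qed fact


section \<open>Lattice points of the square\<close>

definition square :: "nat \<Rightarrow> (int ^ 2) set" where
  "square k = {b. \<forall>i. \<bar>b $ i\<bar> \<le> int k}"

lemma bij_betw_square:
  "bij_betw (\<lambda>(x, y). vector [x, y]) ({- int k..int k} \<times> {- int k..int k}) (square k)"
proof (rule bij_betw_imageI)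
  show "inj_on (\<lambda>(x, y). vector [x, y] :: int ^ 2) ({- int k..int k} \<times> {- int k..int k})"
    by (auto simp: inj_on_def vec_eq_iff forall_2)
  have "b \<in> (\<lambda>(x, y). vector [x, y]) ` ({- int k..int k} \<times> {- int k..int k})"
    if "b \<in> square k" for b
    using that by (intro image_eqI[where x = "(b $ 1, b $ 2)"])
      (auto simp: square_def vec_eq_iff forall_2 abs_le_iff)
  then show "(\<lambda>(x, y). vector [x, y]) ` ({- int k..int k} \<times> {- int k..int k}) = square k"
    by (auto simp: square_def forall_2)
qed

lemma card_square: "card (square k) = (2 * k + 1) ^ 2"
proof -
  have "nat (2 * int k + 1) = 2 * k + 1" by simp
  then show ?thesis
    using bij_betw_same_card[OF bij_betw_square[of k]]
    by (simp add: card_cartesian_product power2_eq_square)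
qed

lemma finite_square: "finite (square k)"
  using bij_betw_finite[OF bij_betw_square[of k]] by simp

lemma sum_square_1:
  "(\<Sum>a\<in>square 1. F a) = (\<Sum>x\<in>{-1, 0, 1}. \<Sum>y\<in>{-1, 0, 1}. F (vector [x, y]))"
proof -
  have "{- int 1..int 1} = {-1, 0, 1}" by auto
  then show ?thesis
    using sum.reindex_bij_betw[OF bij_betw_square[of 1], of F]
    by (simp only: sum.cartesian_product) (simp add: case_prod_unfold)
qed

text \<open>The square has the integer decomposition property: subtracting the sign vector, which is a
  lattice point of the unit square, moves a point of the \<open>Suc k\<close>-th dilate into the \<open>k\<close>-th.\<close>

lemma square_Suc: "square (Suc k) = {b + a | b a. b \<in> square k \<and> a \<in> square 1}"
proof
  show "square (Suc k) \<subseteq> {b + a | b a. b \<in> square k \<and> a \<in> square 1}"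
  proof
    fix b assume b: "b \<in> square (Suc k)"
    define a :: "int ^ 2" where "a = (\<chi> i. sgn (b $ i))"
    have "a \<in> square 1" by (auto simp: a_def square_def sgn_if)
    moreover have "b - a \<in> square k"
    proof -
      have "\<bar>b $ i - sgn (b $ i)\<bar> \<le> int k" for i
        using b by (cases "b $ i" "0 :: int" rule: linorder_cases)
          (auto simp: square_def abs_le_iff dest!: spec[of _ i])
      then show ?thesis by (simp add: a_def square_def)
    qed
    moreover have "b = (b - a) + a" by simp
    ultimately show "b \<in> {b + a | b a. b \<in> square k \<and> a \<in> square 1}" by blast
  qed
  show "{b + a | b a. b \<in> square k \<and> a \<in> square 1} \<subseteq> square (Suc k)"
  proof clarify
    fix b a assume ba: "b \<in> square k" "a \<in> square 1"
    have "\<bar>(b + a) $ i\<bar> \<le> int (Suc k)" for i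
    proof -
      have "\<bar>b $ i\<bar> \<le> int k" "\<bar>a $ i\<bar> \<le> 1" using ba by (auto simp: square_def)
      then show ?thesis using abs_triangle_ineq[of "b $ i" "a $ i"] by simp
    qed
    then show "b + a \<in> square (Suc k)" by (simp add: square_def)
  qed
qed

lemma convex_combination_4:
  fixes a b c d :: "'a::real_vector"
  assumes "\<alpha> \<ge> 0" "\<beta> \<ge> 0" "\<gamma> \<ge> 0" "\<delta> \<ge> 0" "\<alpha> + \<beta> + \<gamma> + \<delta> = 1"
  shows "\<alpha> *\<^sub>R a + \<beta> *\<^sub>R b + \<gamma> *\<^sub>R c + \<delta> *\<^sub>R d \<in> convex hull {a, b, c, d}"
proof -
  let ?w = "\<lambda>i::nat. [\<alpha>, \<beta>, \<gamma>, \<delta>] ! i" and ?v = "\<lambda>i. [a, b, c, d] ! i"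
  have four: "{..<4::nat} = {0, 1, 2, 3}" by auto
  have "(\<Sum>i<4. ?w i *\<^sub>R ?v i) \<in> convex hull {a, b, c, d}"
    by (rule convex_sum) (use assms in \<open>auto simp: four intro: hull_inc\<close>)
  then show ?thesis by (simp add: four add.assoc)
qed

lemma P8a_eq_cbox: "P8a = cbox (vector [-1, -1]) (vector [1, 1])"
proof
  show "P8a \<subseteq> cbox (vector [-1, -1]) (vector [1, 1])"
    unfolding P8a_def by (rule hull_minimal) (auto simp: mem_box_cart forall_2)
  show "cbox (vector [-1, -1]) (vector [1, 1]) \<subseteq> P8a"
  proof
    fix z :: "real ^ 2"
    assume "z \<in> cbox (vector [-1, -1]) (vector [1, 1])"
    then have z: "-1 \<le> z $ 1" "z $ 1 \<le> 1" "-1 \<le> z $ 2" "z $ 2 \<le> 1"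
      by (auto simp: mem_box_cart forall_2)
    \<comment> \<open>The weights are the products of the weights of the two coordinates in \<open>[-1, 1]\<close>.\<close>
    have "((1 - z $ 1) * (1 - z $ 2) / 4) *\<^sub>R vector [-1, -1]
        + ((1 - z $ 1) * (1 + z $ 2) / 4) *\<^sub>R vector [-1, 1]
        + ((1 + z $ 1) * (1 - z $ 2) / 4) *\<^sub>R vector [1, -1]
        + ((1 + z $ 1) * (1 + z $ 2) / 4) *\<^sub>R vector [1, 1] \<in> P8a" (is "?w \<in> _")
      unfolding P8a_def
    proof (rule convex_combination_4)
      show "(1 - z $ 1) * (1 - z $ 2) / 4 + (1 - z $ 1) * (1 + z $ 2) / 4 +
          (1 + z $ 1) * (1 - z $ 2) / 4 + (1 + z $ 1) * (1 + z $ 2) / 4 = 1"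
        by (simp add: field_simps)
    qed (use z in simp_all)
    also have "?w = z"
      by (simp add: vec_eq_iff forall_2 field_simps)
    finally show "z \<in> P8a" .
  qed
qed

lemma lattice_points_P8a: "lattice_points P8a = square 1"
  by (auto simp: lattice_points_def P8a_eq_cbox mem_box_cart forall_2 square_def abs_le_iff)

lemma lattice_points_frontier_P8a: "lattice_points (frontier P8a) = square 1 - {0}"
proof -
  have int_0: "-1 < (of_int n :: real) \<and> (of_int n :: real) < 1 \<longleftrightarrow> n = 0" for n
    by (auto; linarith)
  have "lattice_points (frontier P8a) =
      lattice_points P8a - lattice_points (box (vector [-1, -1]) (vector [1, 1]))"
    by (auto simp: P8a_eq_cbox frontier_cbox lattice_points_def)
  also have "lattice_points (box (vector [-1, -1]) (vector [1, 1])) = {0 :: int ^ 2}"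
    by (auto simp: lattice_points_def mem_box_cart forall_2 int_0 vec_eq_iff)
  finally show ?thesis by (simp add: lattice_points_P8a)
qed

lemma polar_dual_P8a:
  "polar_dual P8a = convex hull {vector [1, 0], vector [-1, 0], vector [0, 1], vector [0, -1]}"
proof
  show "convex hull {vector [1, 0], vector [-1, 0], vector [0, 1], vector [0, -1]} \<subseteq> polar_dual P8a"
  proof (rule hull_minimal)
    show "convex (polar_dual P8a)"
    proof -
      have "polar_dual P8a = (\<Inter>x\<in>P8a. {y. x \<bullet> y \<ge> -1})" by (auto simp: polar_dual_def)
      then show ?thesis by (simp add: convex_INT convex_halfspace_ge)
    qed
  qed (auto simp: polar_dual_def P8a_eq_cbox mem_box_cart forall_2 inner_vec_def sum_2)
  show "polar_dual P8a \<subseteq> convex hull {vector [1, 0], vector [-1, 0], vector [0, 1], vector [0, -1]}"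
  proof
    fix y assume y: "y \<in> polar_dual P8a"
    have "{vector [-1, -1], vector [-1, 1], vector [1, -1], vector [1, 1]} \<subseteq> P8a"
      unfolding P8a_def by (rule hull_subset)
    moreover have "\<forall>x\<in>P8a. x \<bullet> y \<ge> -1" using y by (simp add: polar_dual_def)
    ultimately have "\<forall>x\<in>{vector [-1, -1], vector [-1, 1], vector [1, -1], vector [1, 1]}. x \<bullet> y \<ge> -1"
      by (meson subsetD)
    then have abs: "\<bar>y $ 1\<bar> + \<bar>y $ 2\<bar> \<le> 1"
      by (auto simp: inner_vec_def sum_2)
    \<comment> \<open>The slack is spread evenly, which changes nothing as the four points sum to zero.\<close>
    define s where "s = (1 - \<bar>y $ 1\<bar> - \<bar>y $ 2\<bar>) / 4"
    have "(max (y $ 1) 0 + s) *\<^sub>R vector [1, 0] + (max (- y $ 1) 0 + s) *\<^sub>R vector [-1, 0]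
        + (max (y $ 2) 0 + s) *\<^sub>R vector [0, 1] + (max (- y $ 2) 0 + s) *\<^sub>R vector [0, -1]
      \<in> convex hull {vector [1, 0], vector [-1, 0], vector [0, 1], vector [0, -1] :: real ^ 2}"
      (is "?w \<in> _")
      by (rule convex_combination_4) (use abs in \<open>auto simp: s_def max_def abs_if field_simps\<close>)
    also have "?w = y"
      by (auto simp: vec_eq_iff forall_2 max_def)
    finally show "y \<in> convex hull {vector [1, 0], vector [-1, 0], vector [0, 1], vector [0, -1]}" .
  qed
qed

lemma reflexive_P8a: "reflexive P8a"
proof -
  let ?\<iota> = "\<lambda>a :: int ^ 2. \<chi> i. real_of_int (a $ i)"
  have vec: "?\<iota> (vector [x, y]) = vector [real_of_int x, real_of_int y]" for x y
    by (simp add: vec_eq_iff forall_2)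
  have "lattice_polytope P8a"
    unfolding lattice_polytope_def P8a_def
    by (rule exI[where x = "{vector [-1, -1], vector [-1, 1], vector [1, -1], vector [1, 1]}"])
      (simp add: vec)
  moreover have "0 \<in> interior P8a"
    by (simp add: P8a_eq_cbox interior_cbox mem_box_cart forall_2)
  moreover have "lattice_polytope (polar_dual P8a)"
    unfolding lattice_polytope_def polar_dual_P8a
    by (rule exI[where x = "{vector [1, 0], vector [-1, 0], vector [0, 1], vector [0, -1]}"])
      (simp add: vec)
  ultimately show ?thesis by (simp add: reflexive_def)
qed


section \<open>The degree\<close>

lemma multidegree_monomials_P8a:
  fixes A :: "int ^ 'n::finite ^ 2"
  assumes "design_matrix A P8a"
  shows "multidegree A ` monomials k = square k"
proof (induction k)
  case 0
  have "square 0 = {0}" by (auto simp: square_def vec_eq_iff)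
  then show ?case by (simp add: multidegree_monomials_0)
next
  case (Suc k)
  have "square 1 = range (\<lambda>j. column j A)"
    using assms by (simp add: design_matrix_def bij_betw_def lattice_points_P8a)
  then show ?case
    unfolding multidegree_monomials_Suc Suc.IH square_Suc by (simp only:) auto
qed

text \<open>The Hilbert polynomial \<open>(2 k + 1)\<^sup>2\<close> has degree \<open>2\<close> and leading coefficient \<open>4\<close>, whence
  \<open>2! \<cdot> 4 = 8\<close>.\<close>

lemma cone_degree_P8a:
  fixes A :: "int ^ 'n::finite ^ 2"
  assumes "design_matrix A P8a"
  shows "cone_degree (toric_variety A) = 8"
proof -
  have "hilbert_function (toric_variety A) k = (2 * k + 1) ^ 2" for k
    by (simp add: hilbert_function_toric_variety multidegree_monomials_P8a[OF assms] card_square)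
  then have "hilbert_polynomial (toric_variety A) = [:1, 4, 4:]"
    by (intro hilbert_polynomial_eqI always_eventually) (simp add: power2_eq_square algebra_simps)
  then show ?thesis by (simp add: cone_degree_def numeral_2_eq_2)
qed


section \<open>Points of the toric variety with nonzero coordinates\<close>

text \<open>Such a point is determined by its coordinates at \<open>0\<close> and the unit vectors: the binomial
  expressing the coordinate at \<open>a\<close> through these, with negative exponents moved to the other
  side, vanishes on the image of the torus and hence on its closure.\<close>

lemma toric_variety_torus_point:
  fixes A :: "int ^ 'n::finite ^ 'd::finite"
  assumes origin: "column j\<^sub>0 A = 0" and unit: "\<And>i. column (e i) A = axis i 1"
    and p: "p \<in> toric_variety A" "\<forall>j. p $ j \<noteq> 0"
  shows "p = toric_map A (p $ j\<^sub>0) (\<chi> i. p $ e i / p $ j\<^sub>0)"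
proof -
  have coordinate: "p $ j = p $ j\<^sub>0 * (\<Prod>i\<in>UNIV. (p $ e i / p $ j\<^sub>0) powi (column j A $ i))" for j
  proof -
    define a where "a = column j A"
    define L where "L = Poly_Mapping.single j 1
      + Poly_Mapping.single j\<^sub>0 (\<Sum>i\<in>UNIV. nat (a $ i))
      + (\<Sum>i\<in>UNIV. Poly_Mapping.single (e i) (nat (- a $ i)))"
    define R where "R = Poly_Mapping.single j\<^sub>0 (Suc (\<Sum>i\<in>UNIV. nat (- a $ i)))
      + (\<Sum>i\<in>UNIV. Poly_Mapping.single (e i) (nat (a $ i)))"
    have binomial: "mon_value L x = mon_value R x \<longleftrightarrow>
        x $ j = x $ j\<^sub>0 * (\<Prod>i\<in>UNIV. (x $ e i / x $ j\<^sub>0) powi (a $ i))"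
      if x: "x $ j\<^sub>0 \<noteq> 0" "\<And>i. x $ e i \<noteq> 0" for x
    proof -
      have powi: "y powi n = y ^ nat n / y ^ nat (- n)" for y :: complex and n
        by (auto simp: power_int_def divide_inverse power_inverse)
      have L: "mon_value L x = x $ j * (x $ j\<^sub>0 ^ (\<Sum>i\<in>UNIV. nat (a $ i)) *
          (\<Prod>i\<in>UNIV. (x $ e i) ^ nat (- a $ i)))"
        unfolding L_def mon_value_add mon_value_sum mon_value_single by simp
      have R: "mon_value R x = x $ j\<^sub>0 * (x $ j\<^sub>0 ^ (\<Sum>i\<in>UNIV. nat (- a $ i)) *
          (\<Prod>i\<in>UNIV. (x $ e i) ^ nat (a $ i)))"
        unfolding R_def mon_value_add mon_value_sum mon_value_single by simp
      have quotient: "(\<Prod>i\<in>UNIV. (x $ e i / x $ j\<^sub>0) powi (a $ i)) =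
          ((x $ j\<^sub>0 ^ (\<Sum>i\<in>UNIV. nat (- a $ i))) * (\<Prod>i\<in>UNIV. (x $ e i) ^ nat (a $ i))) /
          ((x $ j\<^sub>0 ^ (\<Sum>i\<in>UNIV. nat (a $ i))) * (\<Prod>i\<in>UNIV. (x $ e i) ^ nat (- a $ i)))"
        by (simp add: powi power_divide prod_dividef prod.distrib power_sum)
      have "x $ j\<^sub>0 ^ (\<Sum>i\<in>UNIV. nat (a $ i)) *
          (\<Prod>i\<in>UNIV. (x $ e i) ^ nat (- a $ i)) \<noteq> 0"
        using x by simp
      then show ?thesis
        unfolding L R quotient times_divide_eq_right by (rule nonzero_eq_divide_eq[symmetric])
    qed
    have "mon L - mon R \<in> vanishing_ideal (toric_variety A)"
      unfolding toric_variety_def vanishing_ideal_zariski_closure unfolding vanishing_ideal_def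
    proof (intro CollectI ballI, elim CollectE exE conjE)
      fix x s \<theta>
      assume x: "x = toric_map A s \<theta>" and s: "s \<noteq> 0" and \<theta>: "\<forall>i. \<theta> $ i \<noteq> 0"
      have 0: "toric_map A s \<theta> $ j\<^sub>0 = s"
        by (simp add: toric_map_def origin)
      have e: "toric_map A s \<theta> $ e i = s * \<theta> $ i" for i
      proof -
        have "(\<Prod>i'\<in>UNIV. (\<theta> $ i') powi (axis i 1 $ i')) =
            (\<Prod>i'\<in>UNIV. if i' = i then \<theta> $ i' else 1)"
          by (rule prod.cong) (auto simp: axis_def)
        then show ?thesis by (simp add: toric_map_def unit)
      qed
      have "mon_value L (toric_map A s \<theta>) = mon_value R (toric_map A s \<theta>)"
        using s \<theta> by (subst binomial) (simp_all add: 0 e, simp add: toric_map_def a_def)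
      then show "cpoly_eval (mon L - mon R) x = 0"
        by (simp add: x cpoly_eval_diff)
    qed
    then have "mon_value L p = mon_value R p"
      using p(1) by (auto simp: vanishing_ideal_def cpoly_eval_diff)
    then show ?thesis
      using p(2) binomial[of p] by (simp add: a_def)
  qed
  show ?thesis by (simp add: toric_map_def vec_eq_iff flip: coordinate)
qed


section \<open>The score equations\<close>

text \<open>The moment is \<open>x \<partial>/\<partial>x\<close> applied to the sum of the Laurent monomials \<open>x powi a\<close> with
  \<open>a = -1, 0, 1\<close>: it weights each monomial by its exponent, as a row of the design matrix does.\<close>

definition side_sum :: "complex \<Rightarrow> complex" where
  "side_sum x = inverse x + 1 + x"

definition side_moment :: "complex \<Rightarrow> complex" where
  "side_moment x = x - inverse x"

text \<open>The square is a product, so every row of the score equations factors into a function of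
  \<open>x\<close> times a function of \<open>y\<close>.\<close>

lemma extended_matrix_toric_map:
  fixes A :: "int ^ 'n::finite ^ 2"
  assumes "design_matrix A P8a"
  shows "(extended_matrix A *v toric_map A s (vector [x, y])) $ None = s * side_sum x * side_sum y"
    and "(extended_matrix A *v toric_map A s (vector [x, y])) $ Some 1 =
      s * side_moment x * side_sum y"
    and "(extended_matrix A *v toric_map A s (vector [x, y])) $ Some 2 =
      s * side_sum x * side_moment y"
proof -
  have bij: "bij_betw (\<lambda>j. column j A) UNIV (square 1)"
    using assms by (simp add: design_matrix_def lattice_points_P8a)
  let ?t = "\<lambda>a :: int ^ 2. s * (x powi (a $ 1) * y powi (a $ 2))"
  have t: "toric_map A s (vector [x, y]) $ j = ?t (column j A)" for j
    by (simp add: toric_map_def UNIV_2)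
  have "(extended_matrix A *v toric_map A s (vector [x, y])) $ None = (\<Sum>a\<in>square 1. ?t a)"
    by (simp add: matrix_vector_mult_def extended_matrix_def t sum.reindex_bij_betw[OF bij, of ?t]
        del: One_nat_def)
  then show "(extended_matrix A *v toric_map A s (vector [x, y])) $ None =
      s * side_sum x * side_sum y"
    by (simp add: sum_square_1 side_sum_def algebra_simps del: One_nat_def)
  have row: "(extended_matrix A *v toric_map A s (vector [x, y])) $ Some i =
      (\<Sum>a\<in>square 1. of_int (a $ i) * ?t a)" for i
    using sum.reindex_bij_betw[OF bij, of "\<lambda>a. of_int (a $ i) * ?t a"]
    by (simp add: matrix_vector_mult_def extended_matrix_def t del: One_nat_def)
      (simp add: column_def del: One_nat_def)
  show "(extended_matrix A *v toric_map A s (vector [x, y])) $ Some 1 =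
      s * side_moment x * side_sum y"
    by (simp add: row sum_square_1 side_sum_def side_moment_def algebra_simps del: One_nat_def)
  show "(extended_matrix A *v toric_map A s (vector [x, y])) $ Some 2 =
      s * side_sum x * side_moment y"
    by (simp add: row sum_square_1 side_sum_def side_moment_def algebra_simps del: One_nat_def)
qed

definition side_solutions :: "real \<Rightarrow> complex set" where
  "side_solutions \<beta> = {x. x \<noteq> 0 \<and> side_moment x = of_real \<beta> * side_sum x}"

text \<open>Multiplied by \<open>x\<close>, the equation is quadratic with discriminant \<open>4 - 3 \<beta>\<^sup>2\<close>, and its leading
  coefficient \<open>1 - \<beta>\<close> and constant coefficient \<open>- (1 + \<beta>)\<close> do not vanish.\<close>

lemma card_side_solutions:
  assumes "\<bar>\<beta>\<bar> < 1"
  shows "card (side_solutions \<beta>) = 2"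
proof -
  define w where "w = sqrt (4 - 3 * \<beta>\<^sup>2)"
  have "\<beta>\<^sup>2 < 1" using assms by (simp add: abs_square_less_1)
  then have w: "w > 0" "w\<^sup>2 = 4 - 3 * \<beta>\<^sup>2" by (simp_all add: w_def)
  have \<beta>: "1 - \<beta> \<noteq> 0" "1 + \<beta> \<noteq> 0" using assms by auto
  have lead: "1 - complex_of_real \<beta> \<noteq> 0"
    using \<beta>(1) by (metis of_real_1 of_real_diff of_real_eq_0_iff)
  define r where "r = complex_of_real ((\<beta> + w) / (2 * (1 - \<beta>)))"
  define r' where "r' = complex_of_real ((\<beta> - w) / (2 * (1 - \<beta>)))"
  have "r \<noteq> r'" using w(1) \<beta> by (auto simp: r_def r'_def of_real_eq_iff simp del: of_real_divide)
  have roots: "(1 - \<beta>) * ((\<beta> + w) / (2 * (1 - \<beta>)) + (\<beta> - w) / (2 * (1 - \<beta>))) = \<beta>"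
    "(1 - \<beta>) * ((\<beta> + w) / (2 * (1 - \<beta>)) * ((\<beta> - w) / (2 * (1 - \<beta>)))) = - (1 + \<beta>)"
  proof -
    have "c * ((\<beta> + w) / (2 * c) + (\<beta> - w) / (2 * c)) = \<beta>"
      "c * ((\<beta> + w) / (2 * c) * ((\<beta> - w) / (2 * c))) = (\<beta> + w) * (\<beta> - w) / (4 * c)"
      if "c \<noteq> 0" for c
      using that by (simp_all add: field_simps)
    note c = this[OF \<beta>(1)]
    show "(1 - \<beta>) * ((\<beta> + w) / (2 * (1 - \<beta>)) + (\<beta> - w) / (2 * (1 - \<beta>))) = \<beta>"
      by (rule c)
    have product: "(\<beta> + w) * (\<beta> - w) = 4 * (1 - \<beta>) * - (1 + \<beta>)"
      using w(2) by (simp add: power2_eq_square algebra_simps)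
    show "(1 - \<beta>) * ((\<beta> + w) / (2 * (1 - \<beta>)) * ((\<beta> - w) / (2 * (1 - \<beta>)))) = - (1 + \<beta>)"
      unfolding c product using \<beta> by (intro nonzero_mult_div_cancel_left) simp
  qed
  have vieta: "(1 - of_real \<beta>) * (r + r') = of_real \<beta>" "(1 - of_real \<beta>) * (r * r') = - (1 + of_real \<beta>)"
    using roots[THEN arg_cong[where f = complex_of_real]] by (simp_all add: r_def r'_def)
  have "x \<in> side_solutions \<beta> \<longleftrightarrow> x = r \<or> x = r'" for x
  proof -
    have nz: "x \<noteq> 0" if "(1 - of_real \<beta>) * x\<^sup>2 - of_real \<beta> * x - (1 + of_real \<beta>) = 0"
    proof
      assume "x = 0"
      moreover have "1 + of_real \<beta> = (1 - of_real \<beta>) * x\<^sup>2 - of_real \<beta> * x"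
        using that by (simp only: right_minus_eq)
      ultimately have "complex_of_real (1 + \<beta>) = 0" by simp
      then show False using \<beta> by (simp only: of_real_eq_0_iff)
    qed
    have "x \<in> side_solutions \<beta> \<longleftrightarrow>
        x \<noteq> 0 \<and> (1 - of_real \<beta>) * x\<^sup>2 - of_real \<beta> * x - (1 + of_real \<beta>) = 0"
      by (auto simp: side_solutions_def side_sum_def side_moment_def field_simps power2_eq_square)
    also have "\<dots> \<longleftrightarrow> (1 - of_real \<beta>) * x\<^sup>2 - of_real \<beta> * x - (1 + of_real \<beta>) = 0"
      using nz by blast
    also have "(1 - of_real \<beta>) * x\<^sup>2 - of_real \<beta> * x - (1 + of_real \<beta>) =
        (1 - of_real \<beta>) * x\<^sup>2 - (1 - of_real \<beta>) * (r + r') * x + (1 - of_real \<beta>) * (r * r')"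
      by (simp only: vieta) simp
    also have "\<dots> = (1 - of_real \<beta>) * ((x - r) * (x - r'))"
      by (simp add: algebra_simps power2_eq_square)
    also have "\<dots> = 0 \<longleftrightarrow> x = r \<or> x = r'"
      using lead by simp
    finally show ?thesis .
  qed
  then have "side_solutions \<beta> = {r, r'}" by blast
  then show ?thesis using \<open>r \<noteq> r'\<close> by simp
qed

lemma side_sum_nonzero:
  assumes "x \<in> side_solutions \<beta>"
  shows "side_sum x \<noteq> 0"
proof
  assume sum: "side_sum x = 0"
  then have "x = inverse x" using assms by (simp add: side_solutions_def side_moment_def)
  then have "x\<^sup>2 = 1" using assms by (simp add: side_solutions_def field_simps power2_eq_square)
  then have "x = 1 \<or> x = -1" by (simp add: power2_eq_1_iff)
  then show False using sum by (auto simp: side_sum_def)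
qed

text \<open>The first score equation makes \<open>s\<close> and both side sums nonzero and determines \<open>s\<close>. Dividing
  the other two by it leaves one quadratic equation for \<open>x\<close> and one for \<open>y\<close>, whose parameters are
  the coordinates of the mean lattice point of the data. If all counts are positive, this mean lies
  in the interior of the square, so both quadratics have two admissible roots.\<close>

lemma card_score_solutions_P8a:
  fixes A :: "int ^ 'n::finite ^ 2" and u :: "nat ^ 'n"
  assumes A: "design_matrix A P8a" and u: "\<forall>j. u $ j \<noteq> 0"
  shows "finite (score_solutions A u) \<and> card (score_solutions A u) = 4"
proof -
  have bij: "bij_betw (\<lambda>j. column j A) UNIV (square 1)"
    using A by (simp add: design_matrix_def lattice_points_P8a)
  have surj: "\<exists>j. column j A = a" if "a \<in> square 1" for a
    using bij that by (metis bij_betw_imp_surj_on imageE)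
  have entry: "\<bar>A $ i $ j\<bar> \<le> 1" for i j
    using bij_betw_apply[OF bij, of j] by (simp add: square_def column_def)
  obtain j\<^sub>0 where j\<^sub>0: "column j\<^sub>0 A = 0" using surj[of 0] by (auto simp: square_def)
  have "\<exists>j. column j A = axis i 1" for i
    by (rule surj) (auto simp: square_def axis_def)
  then obtain e where e: "\<And>i. column (e i) A = axis i 1" by metis
  define n where "n = (\<Sum>j\<in>UNIV. real (u $ j))"
  define \<beta> where "\<beta> i = (\<Sum>j\<in>UNIV. real_of_int (A $ i $ j) * real (u $ j)) / n" for i
  have "n > 0" unfolding n_def using u by (intro sum_pos) auto
  \<comment> \<open>The inequality is strict because the lattice point \<open>0\<close> has positive count.\<close>
  have \<beta>: "\<bar>\<beta> i\<bar> < 1" for i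
  proof -
    have "\<bar>\<Sum>j\<in>UNIV. real_of_int (A $ i $ j) * real (u $ j)\<bar> \<le>
        (\<Sum>j\<in>UNIV. \<bar>real_of_int (A $ i $ j)\<bar> * real (u $ j))"
      using sum_abs[of "\<lambda>j. real_of_int (A $ i $ j) * real (u $ j)" UNIV] by (simp add: abs_mult)
    also have "\<dots> < n"
      unfolding n_def
    proof (rule sum_strict_mono_ex1)
      show "\<forall>j\<in>UNIV. \<bar>real_of_int (A $ i $ j)\<bar> * real (u $ j) \<le> real (u $ j)"
        using entry by (auto intro!: mult_left_le_one_le simp flip: of_int_abs)
      have "A $ i $ j\<^sub>0 = 0" using j\<^sub>0 by (simp add: column_def vec_eq_iff)
      then show "\<exists>j\<in>UNIV. \<bar>real_of_int (A $ i $ j)\<bar> * real (u $ j) < real (u $ j)"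
        using u by (intro bexI[of _ j\<^sub>0]) auto
    qed simp
    finally show ?thesis using \<open>n > 0\<close> by (simp add: \<beta>_def)
  qed
  let ?rhs = "(1 / of_nat (\<Sum>j\<in>UNIV. u $ j)) *s (extended_matrix A *v (\<chi> j. of_nat (u $ j)))"
  have n: "of_nat (\<Sum>j\<in>UNIV. u $ j) = complex_of_real n" by (simp add: n_def)
  have rhs: "?rhs $ None = 1" "?rhs $ Some i = of_real (\<beta> i)" for i
    using \<open>n > 0\<close> unfolding n
    by (simp_all add: matrix_vector_mult_def extended_matrix_def \<beta>_def) (simp add: n_def)
  have score: "extended_matrix A *v toric_map A s (vector [x, y]) = ?rhs \<longleftrightarrow>
      s * side_sum x * side_sum y = 1 \<and> s * side_moment x * side_sum y = of_real (\<beta> 1) \<and>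
      s * side_sum x * side_moment y = of_real (\<beta> 2)" for s x y
  proof -
    have "(v :: complex ^ 2 option) = v' \<longleftrightarrow>
        v $ None = v' $ None \<and> v $ Some 1 = v' $ Some 1 \<and> v $ Some 2 = v' $ Some 2" for v v'
    proof -
      have "(\<forall>r. P r) \<longleftrightarrow> P None \<and> P (Some 1) \<and> P (Some (2 :: 2))" for P
        by (metis (full_types) exhaust_2 option.exhaust)
      then show ?thesis by (simp only: vec_eq_iff)
    qed
    then show ?thesis by (simp only: extended_matrix_toric_map[OF A] rhs)
  qed
  define sol where "sol = (\<lambda>(x, y). toric_map A (1 / (side_sum x * side_sum y)) (vector [x, y]))"
  have "score_solutions A u = sol ` (side_solutions (\<beta> 1) \<times> side_solutions (\<beta> 2))"
  proof
    show "score_solutions A u \<subseteq> sol ` (side_solutions (\<beta> 1) \<times> side_solutions (\<beta> 2))"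
    proof
      fix p assume p: "p \<in> score_solutions A u"
      define s x y where "s = p $ j\<^sub>0" and "x = p $ e 1 / p $ j\<^sub>0" and "y = p $ e 2 / p $ j\<^sub>0"
      have "(\<chi> i. p $ e i / p $ j\<^sub>0) = vector [x, y]"
        by (simp add: vec_eq_iff forall_2 x_def y_def)
      then have p_eq: "p = toric_map A s (vector [x, y])"
        using toric_variety_torus_point[OF j\<^sub>0 e, of p] p by (simp add: score_solutions_def s_def)
      have nz: "x \<noteq> 0" "y \<noteq> 0" using p by (auto simp: score_solutions_def x_def y_def)
      have eqs: "s * side_sum x * side_sum y = 1" "s * side_moment x * side_sum y = of_real (\<beta> 1)"
        "s * side_sum x * side_moment y = of_real (\<beta> 2)"
        using p score by (auto simp: score_solutions_def p_eq)
      then have s: "s \<noteq> 0" "side_sum x \<noteq> 0" "side_sum y \<noteq> 0" by auto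
      have "s * side_sum y * side_moment x = s * side_sum y * (of_real (\<beta> 1) * side_sum x)"
        "s * side_sum x * side_moment y = s * side_sum x * (of_real (\<beta> 2) * side_sum y)"
        using eqs by (simp_all add: algebra_simps)
      then have "x \<in> side_solutions (\<beta> 1)" "y \<in> side_solutions (\<beta> 2)"
        using s nz by (simp_all add: side_solutions_def)
      moreover have "s = 1 / (side_sum x * side_sum y)"
        using eqs(1) s by (simp add: field_simps)
      ultimately show "p \<in> sol ` (side_solutions (\<beta> 1) \<times> side_solutions (\<beta> 2))"
        unfolding p_eq sol_def by (intro image_eqI[where x = "(x, y)"]) auto
    qed
    show "sol ` (side_solutions (\<beta> 1) \<times> side_solutions (\<beta> 2)) \<subseteq> score_solutions A u"
    proof clarify
      fix x y assume xy: "x \<in> side_solutions (\<beta> 1)" "y \<in> side_solutions (\<beta> 2)"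
      note nz = side_sum_nonzero[OF xy(1)] side_sum_nonzero[OF xy(2)]
      have xy0: "x \<noteq> 0" "y \<noteq> 0" using xy by (auto simp: side_solutions_def)
      have "extended_matrix A *v sol (x, y) = ?rhs"
        unfolding sol_def prod.case score using nz xy by (simp add: side_solutions_def)
      moreover have "sol (x, y) \<in> toric_variety A"
        unfolding toric_variety_def zariski_closure_def
        by (rule hull_inc, rule CollectI,
            rule exI[of _ "1 / (side_sum x * side_sum y)"], rule exI[of _ "vector [x, y]"])
          (use nz xy0 in \<open>simp add: sol_def forall_2\<close>)
      moreover have "sol (x, y) $ j \<noteq> 0" for j
        using nz xy0 by (simp add: sol_def toric_map_def UNIV_2)
      ultimately show "sol (x, y) \<in> score_solutions A u"
        by (simp add: score_solutions_def)
    qed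
  qed
  moreover have "inj_on sol (side_solutions (\<beta> 1) \<times> side_solutions (\<beta> 2))"
  proof -
    have "sol (x, y) $ e 1 / sol (x, y) $ j\<^sub>0 = x \<and> sol (x, y) $ e 2 / sol (x, y) $ j\<^sub>0 = y"
      if "x \<in> side_solutions (\<beta> 1)" "y \<in> side_solutions (\<beta> 2)" for x y
      using that[THEN side_sum_nonzero]
      by (simp add: sol_def toric_map_def j\<^sub>0 e UNIV_2 axis_def)
    then show ?thesis
      by (intro inj_onI) (clarsimp, metis)
  qed
  moreover have "finite (side_solutions (\<beta> i))" "card (side_solutions (\<beta> i)) = 2" for i
    using card_side_solutions[OF \<beta>[of i]] card.infinite by fastforce+
  ultimately show ?thesis by (simp add: card_image card_cartesian_product)
qed

text \<open>The coordinate hyperplanes, the zero set of the product of all coordinates, contain all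
  exceptional data.\<close>

lemma mldeg_P8a:
  fixes A :: "int ^ 'n::finite ^ 2"
  assumes "design_matrix A P8a"
  shows "mldeg A = 4"
proof -
  let ?Q = "\<lambda>m (u :: nat ^ 'n). finite (score_solutions A u) \<and> card (score_solutions A u) = m"
  have "generic_data (?Q 4)"
    unfolding generic_data_def
  proof (intro exI conjI allI impI)
    let ?f = "mon (\<Sum>j\<in>UNIV. Poly_Mapping.single j 1) :: 'n cpoly"
    show "?f \<noteq> 0" by (metis lookup_single_eq lookup_zero zero_neq_one)
    fix u :: "nat ^ 'n"
    assume "cpoly_eval ?f (\<chi> j. of_nat (u $ j)) \<noteq> 0"
    then have "\<forall>j. u $ j \<noteq> 0"
      by (simp add: mon_value_sum mon_value_single)
    then show "finite (score_solutions A u)" "card (score_solutions A u) = 4"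
      using card_score_solutions_P8a[OF assms] by auto
  qed
  then show ?thesis
    unfolding mldeg_def using generic_data_common_instance[of "?Q 4"]
    by (intro the_equality) blast+
qed

theorem proposition3p1:
  fixes A :: "int ^ 'n::finite ^ 2"
  assumes "design_matrix A P8a"
  shows "reflexive P8a \<and> card (lattice_points P8a) = 9 \<and>
    card (lattice_points (frontier P8a)) = 8 \<and>
    ml_degree_drop A \<and> cone_degree (toric_variety A) = 8 \<and> mldeg A = 4"
proof -
  have "0 \<in> square 1" by (simp add: square_def)
  then have "card (square 1 - {0}) = 8"
    by (simp add: card_square finite_square)
  then show ?thesis
    using reflexive_P8a cone_degree_P8a[OF assms] mldeg_P8a[OF assms]
    by (simp add: lattice_points_P8a lattice_points_frontier_P8a card_square ml_degree_drop_def)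
qed

end
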